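(* Let $n\ge2$, let $D_{2n}=\langle r,s\mid r^n=s^2=1,\ rs=sr^{-1}\rangle$ be the dihedral group of order $2n$, and let $d_1,\dots,d_t$ be the distinct proper divisors of $n$ (divisors $d$ with $1<d<n$). Then the power graph of $D_{2n}$ is the joined union $$P(D_{2n})=\mathscr{G}[K_1,K_{\phi(n)},K_{\phi(d_1)},K_{\phi(d_2)},\dots,K_{\phi(d_t)},\overline{K_n}],$$ where $\mathscr{G}$ is the graph with vertices $v,v',v_1,\dots,v_t,v_{t+1}$ (corresponding in this order to the listed graphs) whose adjacencies are exactly: $v$ is adjacent to every other vertex; $v'$ is adjacent to $v_i$ for all $1\le i\le t$; and, for $1\le i<j\le t$, $v_i$ is adjacent to $v_j$ if and only if one of $d_i,d_j$ divides the other. In particular $v_{t+1}$ is adjacent only to $v$.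
   Context: For a finite group $\mathcal{G}$, the power graph $P(\mathcal{G})$ is the simple graph with vertex set $\mathcal{G}$ in which two distinct elements are adjacent if one is a positive power of the other. $\phi$ is Euler's totient function, $K_m$ the complete graph and $\overline{K_m}$ the edgeless graph on $m$ vertices. For a graph $\mathscr{G}$ with vertices $u_1,\dots,u_m$, the joined union $\mathscr{G}[\mathscr{G}_1,\dots,\mathscr{G}_m]$ is obtained from the disjoint union of $\mathscr{G}_1,\dots,\mathscr{G}_m$ by joining every vertex of $\mathscr{G}_i$ to every vertex of $\mathscr{G}_j$ whenever $u_i\sim u_j$ in $\mathscr{G}$. Equality of graphs means isomorphism. *)

theory Defs
  imports
    "HOL-Algebra.Group"
    "HOL-Number_Theory.Totient"
    "Graph_Theory.Graph_Theory"
begin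

section \<open>Groups given by generators and relations\<close>

text \<open>
  A letter \<open>(x, True)\<close> stands for the generator \<open>x\<close>, a letter \<open>(x, False)\<close> for its formal
  inverse. Every element of the type \<open>'g\<close> is a generator, and a pair of words \<open>(l, r)\<close> in \<open>R\<close>
  is the relation \<open>l = r\<close>.
\<close>

type_synonym 'g word = "('g \<times> bool) list"

inductive pres_eq :: "('g word \<times> 'g word) set \<Rightarrow> 'g word \<Rightarrow> 'g word \<Rightarrow> bool"
  for R :: "('g word \<times> 'g word) set"
where
  refl: "pres_eq R w w"
| sym: "pres_eq R u w \<Longrightarrow> pres_eq R w u"
| trans: "pres_eq R u v \<Longrightarrow> pres_eq R v w \<Longrightarrow> pres_eq R u w"
| cancel: "pres_eq R (u @ [(x, b), (x, \<not> b)] @ w) (u @ w)"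
| rel: "(l, r) \<in> R \<Longrightarrow> pres_eq R (u @ l @ w) (u @ r @ w)"

definition pres_class :: "('g word \<times> 'g word) set \<Rightarrow> 'g word \<Rightarrow> 'g word set"
  where "pres_class R w = {w'. pres_eq R w w'}"

definition presented_group :: "('g word \<times> 'g word) set \<Rightarrow> 'g word set monoid"
  where "presented_group R =
    \<lparr>carrier = range (pres_class R),
     monoid.mult = (\<lambda>A B. \<Union>u\<in>A. \<Union>w\<in>B. pres_class R (u @ w)),
     monoid.one = pres_class R []\<rparr>"

lemma pres_eq_append:
  assumes "pres_eq R u u'" "pres_eq R w w'"
  shows "pres_eq R (u @ w) (u' @ w')"
proof -
  have left: "pres_eq R (p @ u) (p @ u')" if "pres_eq R u u'" for p u u'
    using that
  proof (induction rule: pres_eq.induct)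
    case (cancel u x b w)
    then show ?case using pres_eq.cancel[of R "p @ u" x b w] by simp
  next
    case (rel l r u w)
    then show ?case using pres_eq.rel[of l r R "p @ u" w] by simp
  qed (auto intro: pres_eq.intros(1-3))
  have right: "pres_eq R (u @ p) (u' @ p)" if "pres_eq R u u'" for p u u'
    using that
  proof (induction rule: pres_eq.induct)
    case (cancel u x b w)
    then show ?case using pres_eq.cancel[of R u x b "w @ p"] by simp
  next
    case (rel l r u w)
    then show ?case using pres_eq.rel[of l r R u "w @ p"] by simp
  qed (auto intro: pres_eq.intros(1-3))
  show ?thesis
    using left[OF assms(2), of u] right[OF assms(1), of w'] by (auto intro: pres_eq.trans)
qed

lemma pres_class_eq_iff: "pres_class R u = pres_class R w \<longleftrightarrow> pres_eq R u w"
  unfolding pres_class_def by (auto intro: pres_eq.intros(1-3))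

lemma presented_group_mult:
  "pres_class R u \<otimes>\<^bsub>presented_group R\<^esub> pres_class R w = pres_class R (u @ w)"
proof -
  have "pres_class R (u' @ w') = pres_class R (u @ w)"
    if "u' \<in> pres_class R u" "w' \<in> pres_class R w" for u' w'
    using that pres_eq_append[of R u u' w w'] pres_class_eq_iff[of R "u @ w" "u' @ w'"]
    by (simp add: pres_class_def)
  moreover have "u \<in> pres_class R u" "w \<in> pres_class R w"
    by (auto simp: pres_class_def intro: pres_eq.refl)
  ultimately have "(\<Union>u'\<in>pres_class R u. \<Union>w'\<in>pres_class R w. pres_class R (u' @ w'))
      = pres_class R (u @ w)"
    by blast
  then show ?thesis by (simp add: presented_group_def)
qed

lemma pres_eq_inverse:
  "pres_eq R (map (\<lambda>(x, b). (x, \<not> b)) (rev w) @ w) []"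
proof (induction w)
  case Nil
  show ?case by (simp add: pres_eq.refl)
next
  case (Cons a w)
  obtain x b where a: "a = (x, b)" by (cases a)
  have "pres_eq R (map (\<lambda>(x, b). (x, \<not> b)) (rev w) @ [(x, \<not> b), (x, \<not> \<not> b)] @ w)
     (map (\<lambda>(x, b). (x, \<not> b)) (rev w) @ w)"
    by (rule pres_eq.cancel)
  then show ?case using Cons.IH a by (auto intro: pres_eq.trans)
qed

lemma group_presented_group: "group (presented_group R)"
proof (rule groupI)
  fix A assume "A \<in> carrier (presented_group R)"
  then obtain w where w: "A = pres_class R w" by (auto simp: presented_group_def)
  let ?i = "pres_class R (map (\<lambda>(x, b). (x, \<not> b)) (rev w))"
  have "?i \<otimes>\<^bsub>presented_group R\<^esub> A = \<one>\<^bsub>presented_group R\<^esub>"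
    using pres_eq_inverse[of R w]
    by (simp add: w presented_group_mult pres_class_eq_iff) (simp add: presented_group_def
        pres_class_eq_iff)
  then show "\<exists>B\<in>carrier (presented_group R). B \<otimes>\<^bsub>presented_group R\<^esub> A = \<one>\<^bsub>presented_group R\<^esub>"
    by (intro bexI[of _ ?i]) (auto simp: presented_group_def)
next
  have c: "carrier (presented_group R) = range (pres_class R)"
    and o: "\<one>\<^bsub>presented_group R\<^esub> = pres_class R []" by (simp_all add: presented_group_def)
  show "\<one>\<^bsub>presented_group R\<^esub> \<in> carrier (presented_group R)" by (simp add: c o)
  show "A \<otimes>\<^bsub>presented_group R\<^esub> B \<in> carrier (presented_group R)"
    if "A \<in> carrier (presented_group R)" "B \<in> carrier (presented_group R)" for A B
    using that by (auto simp: c presented_group_mult)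
  show "A \<otimes>\<^bsub>presented_group R\<^esub> B \<otimes>\<^bsub>presented_group R\<^esub> C
      = A \<otimes>\<^bsub>presented_group R\<^esub> (B \<otimes>\<^bsub>presented_group R\<^esub> C)"
    if "A \<in> carrier (presented_group R)" "B \<in> carrier (presented_group R)"
      "C \<in> carrier (presented_group R)" for A B C
    using that by (auto simp: c presented_group_mult)
  show "\<one>\<^bsub>presented_group R\<^esub> \<otimes>\<^bsub>presented_group R\<^esub> A = A"
    if "A \<in> carrier (presented_group R)" for A
    using that by (auto simp: c o presented_group_mult)
qed

datatype dihedral_gen = Rot | Refl

definition dihedral_rels :: "nat \<Rightarrow> (dihedral_gen word \<times> dihedral_gen word) set"
  where "dihedral_rels n =
    {(replicate n (Rot, True), []),
     (replicate 2 (Refl, True), []),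
     ([(Rot, True), (Refl, True)], [(Refl, True), (Rot, False)])}"

definition dihedral_group :: "nat \<Rightarrow> dihedral_gen word set monoid"
  where "dihedral_group n = presented_group (dihedral_rels n)"

section \<open>Graphs\<close>

text \<open>
  As in \<open>Graph_Theory\<close>, a simple graph is a symmetric loopfree digraph without parallel arcs.
  The relation passed to \<open>simple_graph_of\<close> need not be symmetric: an edge is present if the
  relation holds in at least one direction.
\<close>

definition simple_graph_of :: "'a set \<Rightarrow> ('a \<Rightarrow> 'a \<Rightarrow> bool) \<Rightarrow> 'a pair_pre_digraph"
  where "simple_graph_of A P =
    \<lparr>pverts = A, parcs = {(x, y). x \<in> A \<and> y \<in> A \<and> x \<noteq> y \<and> (P x y \<or> P y x)}\<rparr>"

lemma pair_graph_simple_graph_of: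
  assumes "finite A"
  shows "pair_graph (simple_graph_of A P)"
proof -
  have "parcs (simple_graph_of A P) \<subseteq> A \<times> A" by (auto simp: simple_graph_of_def)
  then have "finite (parcs (simple_graph_of A P))" using assms by (auto intro: finite_subset)
  then show ?thesis
    using assms by unfold_locales (auto simp: simple_graph_of_def symmetric_def intro: symI)
qed

definition power_graph :: "('a, 'b) monoid_scheme \<Rightarrow> 'a pair_pre_digraph"
  where "power_graph G = simple_graph_of (carrier G) (\<lambda>x y. \<exists>k::nat. k > 0 \<and> y = x [^]\<^bsub>G\<^esub> k)"

definition complete_graph :: "nat \<Rightarrow> nat pair_pre_digraph"
  where "complete_graph m = simple_graph_of {..<m} (\<lambda>_ _. True)"

lemma "complete_digraph m (with_proj (complete_graph m))"
  unfolding complete_digraph_pair_def by (auto simp: complete_graph_def simple_graph_of_def)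

definition edgeless_graph :: "nat \<Rightarrow> nat pair_pre_digraph"
  where "edgeless_graph m = simple_graph_of {..<m} (\<lambda>_ _. False)"

definition joined_union ::
    "'i pair_pre_digraph \<Rightarrow> ('i \<Rightarrow> 'a pair_pre_digraph) \<Rightarrow> ('i \<times> 'a) pair_pre_digraph"
  where "joined_union H F = simple_graph_of (SIGMA i:pverts H. pverts (F i))
    (\<lambda>(i, x) (j, y). (i, j) \<in> parcs H \<or> (i = j \<and> (x, y) \<in> parcs (F i)))"

section \<open>The outer graph and its blocks\<close>

text \<open>\<open>V\<close>, \<open>V'\<close> and \<open>Vi i\<close> are the vertices $v$, $v'$ and $v_i$.\<close>

datatype outer_vertex = V | V' | Vi nat

definition outer_graph :: "nat \<Rightarrow> (nat \<Rightarrow> nat) \<Rightarrow> outer_vertex pair_pre_digraph"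
  where "outer_graph t d = simple_graph_of ({V, V'} \<union> Vi ` {1..t+1})
    (\<lambda>x y. x = V
         \<or> (x = V' \<and> (\<exists>i\<in>{1..t}. y = Vi i))
         \<or> (\<exists>i\<in>{1..t}. \<exists>j\<in>{1..t}. i < j \<and> x = Vi i \<and> y = Vi j \<and> (d i dvd d j \<or> d j dvd d i)))"

primrec block :: "nat \<Rightarrow> nat \<Rightarrow> (nat \<Rightarrow> nat) \<Rightarrow> outer_vertex \<Rightarrow> nat pair_pre_digraph"
where
  "block n t d V = complete_graph 1"
| "block n t d V' = complete_graph (totient n)"
| "block n t d (Vi i) = (if i = t + 1 then edgeless_graph n else complete_graph (totient (d i)))"

end

(* Modulo the relations every word equals s^e r^k, where the parity e and the residue of k modulo n
   are invariants of its class, so the dihedral group consists of the 2n elements s^e r^a with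
   0 < a <= n. The rotations form a cyclic group, in which an element is a power of another iff its
   order n / gcd(a, n) divides that of the other; the powers of a reflection are itself and 1.
   Sending a rotation to the outer vertex of its order and every reflection to the last outer vertex
   therefore describes the power graph, and the fibre over the order m has phi(m) elements. *)
theory Submission
  imports Defs
begin

section \<open>Normal form of words in the dihedral presentation\<close>

text \<open>Modulo the dihedral relations, a word \<open>w\<close> equals \<open>s^e r^k\<close> with \<open>e = flipped w\<close> and
  \<open>k = rot_exponent w\<close>; prepending \<open>r\<close> to \<open>s r^k\<close> gives \<open>s r^(k-1)\<close>.\<close>

fun flipped :: "dihedral_gen word \<Rightarrow> bool" where
  "flipped [] = False"
| "flipped ((Rot, b) # w) = flipped w"
| "flipped ((Refl, b) # w) = (\<not> flipped w)"

fun rot_exponent :: "dihedral_gen word \<Rightarrow> int" where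
  "rot_exponent [] = 0"
| "rot_exponent ((Rot, b) # w) = rot_exponent w + (if flipped w \<noteq> b then 1 else -1)"
| "rot_exponent ((Refl, b) # w) = rot_exponent w"

lemma flipped_append: "flipped (u @ w) \<longleftrightarrow> flipped u \<noteq> flipped w"
  by (induction u rule: flipped.induct) auto

text \<open>Moving the rotation of \<open>u\<close> to the right across a reflection coming from
  \<open>w\<close> inverts it; hence the sign.\<close>

lemma rot_exponent_append:
  "rot_exponent (u @ w) = (if flipped w then - rot_exponent u else rot_exponent u) + rot_exponent w"
  by (induction u rule: flipped.induct) (auto simp: flipped_append)

lemma flipped_replicate_Rot [simp]: "\<not> flipped (replicate a (Rot, True))"
  by (induction a) auto

lemma rot_exponent_replicate_Rot [simp]: "rot_exponent (replicate a (Rot, True)) = int a"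
  by (induction a) auto

text \<open>The append formulas compute the invariants of a product from those of its factors, so it
  suffices to inspect cancellation and the three relations. Both sides of r s = s r^-1 have exponent
  -1; only r^n = 1 shifts the exponent, by \<open>n\<close> up to sign.\<close>

lemma dihedral_eq_invariants:
  assumes "pres_eq (dihedral_rels n) u w"
  shows "flipped u = flipped w \<and> [rot_exponent u = rot_exponent w] (mod int n)"
  using assms
proof (induction rule: pres_eq.induct)
  case (cancel u x b w)
  have "flipped [(x, b), (x, \<not> b)] = False" "rot_exponent [(x, b), (x, \<not> b)] = 0"
    by (cases x; simp)+
  then show ?case by (simp only: flipped_append rot_exponent_append) simp
next
  case (rel l r u w)
  then have "flipped l = flipped r \<and> [rot_exponent l = rot_exponent r] (mod int n)"
    by (auto simp: dihedral_rels_def numeral_2_eq_2 cong_def)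
  then show ?case
    by (auto simp: flipped_append rot_exponent_append cong_minus_minus_iff
        intro!: cong_add cong_diff)
qed (auto intro: cong_sym cong_trans)

text \<open>Induction on the word: r s = s r^-1 carries each prepended rotation past
  \<open>s\<close>. Whether different normal forms can coincide is not decided here but by the
  invariants.\<close>

lemma dihedral_class_normal_form:
  fixes n :: nat
  defines "G \<equiv> dihedral_group n"
    and "r \<equiv> pres_class (dihedral_rels n) [(Rot, True)]"
    and "s \<equiv> pres_class (dihedral_rels n) [(Refl, True)]"
  shows "r \<in> carrier G" "r [^]\<^bsub>G\<^esub> n = \<one>\<^bsub>G\<^esub>"
    and "pres_class (dihedral_rels n) w = (if flipped w then s else \<one>\<^bsub>G\<^esub>) \<otimes>\<^bsub>G\<^esub> r [^]\<^bsub>G\<^esub> rot_exponent w"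
proof -
  let ?c = "pres_class (dihedral_rels n)"
  interpret group G
    unfolding G_def dihedral_group_def by (rule group_presented_group)
  have closed [simp]: "?c u \<in> carrier G" for u
    by (simp add: G_def dihedral_group_def presented_group_def)
  have one: "\<one>\<^bsub>G\<^esub> = ?c []"
    by (simp add: G_def dihedral_group_def presented_group_def)
  have mult: "?c u \<otimes>\<^bsub>G\<^esub> ?c v = ?c (u @ v)" for u v
    by (simp add: G_def dihedral_group_def presented_group_mult)
  have rel: "?c u = ?c v" if "(u, v) \<in> dihedral_rels n" for u v
    using pres_eq.rel[OF that, of "[]" "[]"] by (simp add: pres_class_eq_iff)
  show r: "r \<in> carrier G" by (simp add: r_def)
  have s: "s \<in> carrier G" by (simp add: s_def)
  have "r [^]\<^bsub>G\<^esub> m = ?c (replicate m (Rot, True))" for m :: nat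
    by (induction m) (simp_all add: one r_def mult replicate_append_same)
  then show "r [^]\<^bsub>G\<^esub> n = \<one>\<^bsub>G\<^esub>"
    unfolding one by (simp only:) (intro rel, simp add: dihedral_rels_def)
  have inverse: "?c [(x, \<not> b)] = inv\<^bsub>G\<^esub> ?c [(x, b)]" for x b
    using pres_eq.cancel[of "dihedral_rels n" "[]" x "\<not> b" "[]"]
    by (intro inv_equality[symmetric]) (simp_all add: mult one pres_class_eq_iff)
  have r': "?c [(Rot, False)] = inv\<^bsub>G\<^esub> r" and s': "?c [(Refl, False)] = inv\<^bsub>G\<^esub> s"
    using inverse[of Rot True] inverse[of Refl True] by (simp_all add: r_def s_def)
  have ss: "s \<otimes>\<^bsub>G\<^esub> s = \<one>\<^bsub>G\<^esub>"
    unfolding s_def mult one by (intro rel) (simp add: dihedral_rels_def numeral_2_eq_2)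
  then have s_inv: "inv\<^bsub>G\<^esub> s = s" using s s by (rule inv_equality)
  have rs: "r \<otimes>\<^bsub>G\<^esub> s = s \<otimes>\<^bsub>G\<^esub> inv\<^bsub>G\<^esub> r"
    unfolding r'[symmetric] unfolding r_def s_def mult
    by (intro rel) (simp add: dihedral_rels_def)
  \<comment> \<open>Multiply \<open>rs\<close> by the inverse of \<open>r\<close> on the left and by
    \<open>r\<close> on the right.\<close>
  then have rs': "inv\<^bsub>G\<^esub> r \<otimes>\<^bsub>G\<^esub> s = s \<otimes>\<^bsub>G\<^esub> r"
    using r s by (metis inv_closed inv_solve_left inv_solve_right m_assoc m_closed)
  \<comment> \<open>The trailing factor \<open>z\<close> makes these laws applicable to the
    right-nested products of the induction below.\<close>
  have push: "r \<otimes>\<^bsub>G\<^esub> (s \<otimes>\<^bsub>G\<^esub> z) = s \<otimes>\<^bsub>G\<^esub> (inv\<^bsub>G\<^esub> r \<otimes>\<^bsub>G\<^esub> z)"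
      "inv\<^bsub>G\<^esub> r \<otimes>\<^bsub>G\<^esub> (s \<otimes>\<^bsub>G\<^esub> z) = s \<otimes>\<^bsub>G\<^esub> (r \<otimes>\<^bsub>G\<^esub> z)"
      "s \<otimes>\<^bsub>G\<^esub> (s \<otimes>\<^bsub>G\<^esub> z) = z"
    if "z \<in> carrier G" for z
    using that r s rs rs' ss by (metis inv_closed l_one m_assoc)+
  \<comment> \<open>These match the steps +1 and -1 in the recursion of
    \<open>rot_exponent\<close>.\<close>
  have pow: "r [^]\<^bsub>G\<^esub> (k + 1) = r \<otimes>\<^bsub>G\<^esub> r [^]\<^bsub>G\<^esub> k" "r [^]\<^bsub>G\<^esub> (k - 1) = inv\<^bsub>G\<^esub> r \<otimes>\<^bsub>G\<^esub> r [^]\<^bsub>G\<^esub> k"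
    for k :: int
    using int_pow_mult[OF r, of 1 k] int_pow_mult[OF r, of "-1" k] r
    by (simp_all add: add.commute int_pow_neg)
  show "?c w = (if flipped w then s else \<one>\<^bsub>G\<^esub>) \<otimes>\<^bsub>G\<^esub> r [^]\<^bsub>G\<^esub> rot_exponent w"
  proof (induction w)
    case Nil
    show ?case by (simp add: one[symmetric])
  next
    case (Cons a w)
    obtain x b where a: "a = (x, b)" by (cases a)
    have *: "?c (a # w) = ?c [(x, b)] \<otimes>\<^bsub>G\<^esub> ((if flipped w then s else \<one>\<^bsub>G\<^esub>) \<otimes>\<^bsub>G\<^esub> r [^]\<^bsub>G\<^esub> rot_exponent w)"
      using Cons.IH by (simp add: a mult flip: Cons.IH)
    have gens: "?c [(x, b)] = (case x of Rot \<Rightarrow> if b then r else inv\<^bsub>G\<^esub> r | Refl \<Rightarrow> s)"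
      by (cases x; cases b) (simp_all add: r' s' s_inv flip: r_def s_def)
    show ?case
      unfolding * gens using r s
      by (cases x; cases b) (simp_all add: a pow push)
  qed
qed

text \<open>One direction is the invariance; for the other, the normal form depends on the exponent
  only modulo \<open>n\<close> because r^n = 1. This solves the word problem, so the presentation
  does not collapse further.\<close>

lemma dihedral_class_eq_iff:
  "pres_class (dihedral_rels n) u = pres_class (dihedral_rels n) w \<longleftrightarrow>
    flipped u = flipped w \<and> [rot_exponent u = rot_exponent w] (mod int n)"
proof
  assume "pres_class (dihedral_rels n) u = pres_class (dihedral_rels n) w"
  then show "flipped u = flipped w \<and> [rot_exponent u = rot_exponent w] (mod int n)"
    by (intro dihedral_eq_invariants) (simp add: pres_class_eq_iff)
next
  interpret G: group "dihedral_group n"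
    unfolding dihedral_group_def by (rule group_presented_group)
  note nf = dihedral_class_normal_form[of n]
  assume inv: "flipped u = flipped w \<and> [rot_exponent u = rot_exponent w] (mod int n)"
  then obtain q where q: "rot_exponent u = rot_exponent w + int n * q"
    by (metis cong_iff_lin cong_sym)
  have "pres_class (dihedral_rels n) [(Rot, True)] [^]\<^bsub>dihedral_group n\<^esub> (int n * q) = \<one>\<^bsub>dihedral_group n\<^esub>"
    using G.int_pow_pow[OF nf(1), of "int n" q] nf(2) by (simp add: int_pow_int)
  then have "pres_class (dihedral_rels n) [(Rot, True)] [^]\<^bsub>dihedral_group n\<^esub> rot_exponent u
      = pres_class (dihedral_rels n) [(Rot, True)] [^]\<^bsub>dihedral_group n\<^esub> rot_exponent w"
    using nf(1) by (simp add: q G.int_pow_mult)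
  then show "pres_class (dihedral_rels n) u = pres_class (dihedral_rels n) w"
    using inv by (simp add: nf(3)[of u] nf(3)[of w])
qed


section \<open>Coordinates for the group elements\<close>

text \<open>The exponent \<open>a\<close> ranges over \<open>{0<..n}\<close>, so that the identity is \<open>(n, False)\<close> and the order
  \<open>n div gcd a n\<close> of a rotation matches the index range of \<open>card_gcd_eq_totient\<close>.\<close>

definition dihedral_elem :: "nat \<Rightarrow> nat \<times> bool \<Rightarrow> dihedral_gen word set" where
  "dihedral_elem n = (\<lambda>(a, e). pres_class (dihedral_rels n)
    ((if e then [(Refl, True)] else []) @ replicate a (Rot, True)))"

lemma dihedral_elem_eq_class_iff:
  "dihedral_elem n (a, e) = pres_class (dihedral_rels n) w \<longleftrightarrow>
    e = flipped w \<and> [int a = rot_exponent w] (mod int n)"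
  by (auto simp: dihedral_elem_def dihedral_class_eq_iff)

lemma cong_imp_eq_Ioc:
  fixes a b n :: nat
  assumes "[a = b] (mod n)" "a \<in> {0<..n}" "b \<in> {0<..n}"
  shows "a = b"
  using assms by (cases "a = n"; cases "b = n") (auto simp: cong_def)

lemma bij_betw_dihedral_elem:
  assumes "n > 0"
  shows "bij_betw (dihedral_elem n) ({0<..n} \<times> UNIV) (carrier (dihedral_group n))"
  unfolding bij_betw_def
proof
  have "a = b \<and> e = f" if "dihedral_elem n (a, e) = dihedral_elem n (b, f)"
    "a \<in> {0<..n}" "b \<in> {0<..n}" for a b e f
  proof -
    have "e = f" "[int a = int b] (mod int n)"
      using that(1) unfolding dihedral_elem_def[of n]
      by (auto simp: dihedral_class_eq_iff split: if_splits)
    then show ?thesis using cong_imp_eq_Ioc[of a b n] that(2,3) by (simp add: cong_int_iff)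
  qed
  then show "inj_on (dihedral_elem n) ({0<..n} \<times> UNIV)"
    by (intro inj_onI) (auto split: prod.splits, (metis (full_types) greaterThanAtMost_iff)+)
  have carrier: "carrier (dihedral_group n) = range (pres_class (dihedral_rels n))"
    by (simp add: dihedral_group_def presented_group_def)
  have "pres_class (dihedral_rels n) w \<in> dihedral_elem n ` ({0<..n} \<times> UNIV)" for w
  proof -
    define q where "q = rot_exponent w mod int n"
    \<comment> \<open>Residue 0 is represented by \<open>n\<close>, since exponents range over
      \<open>{0<..n}\<close>.\<close>
    define a where "a = (if q = 0 then n else nat q)"
    have "0 \<le> q" "q < int n" using assms by (simp_all add: q_def)
    then have "a \<in> {0<..n}" using assms by (auto simp: a_def)
    moreover have "[int a = rot_exponent w] (mod int n)"
      using \<open>0 \<le> q\<close> by (auto simp: a_def cong_def q_def)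
    then have "dihedral_elem n (a, flipped w) = pres_class (dihedral_rels n) w"
      by (simp add: dihedral_elem_eq_class_iff)
    ultimately show ?thesis by (metis SigmaI UNIV_I image_eqI)
  qed
  then show "dihedral_elem n ` ({0<..n} \<times> UNIV) = carrier (dihedral_group n)"
    unfolding carrier by (auto simp: dihedral_elem_def)
qed

section \<open>Powers of elements and divisibility of orders\<close>

lemma pres_class_pow:
  "pres_class R w [^]\<^bsub>presented_group R\<^esub> k = pres_class R (concat (replicate k w))" for k :: nat
proof (induction k)
  case 0
  then show ?case by (simp add: presented_group_def)
next
  case (Suc k)
  \<comment> \<open>The group power adds its new factor on the right, \<open>replicate\<close> on
    the left.\<close>
  have "concat (replicate k w) @ w = w @ concat (replicate k w)"
    by (induction k) auto
  then show ?case by (simp add: Suc.IH presented_group_mult)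
qed

lemma flipped_concat_replicate: "flipped (concat (replicate k w)) \<longleftrightarrow> flipped w \<and> odd k"
  by (induction k) (auto simp: flipped_append)

text \<open>If \<open>w\<close> is a reflection, the exponents of two consecutive copies cancel and
  only the parity of \<open>k\<close> survives; otherwise exponents add up.\<close>

lemma rot_exponent_concat_replicate:
  "rot_exponent (concat (replicate k w)) =
    (if flipped w then if odd k then rot_exponent w else 0 else int k * rot_exponent w)"
  by (induction k) (auto simp: flipped_concat_replicate rot_exponent_append algebra_simps)

lemma dihedral_elem_eq_pow_iff:
  fixes k :: nat
  shows "dihedral_elem n (b, f) = dihedral_elem n (a, e) [^]\<^bsub>dihedral_group n\<^esub> k \<longleftrightarrow>
    f = (e \<and> odd k) \<and> [b = (if e then if odd k then a else 0 else k * a)] (mod n)"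
proof -
  have "int (if e then if odd k then a else 0 else k * a) =
      (if e then if odd k then int a else 0 else int k * int a)"
    by simp
  then show ?thesis
    unfolding cong_int_iff[symmetric]
    by (simp add: dihedral_elem_def[of n] dihedral_group_def pres_class_pow dihedral_class_eq_iff
        flipped_concat_replicate rot_exponent_concat_replicate flipped_append rot_exponent_append
        split del: if_split) auto
qed

text \<open>The multiples of \<open>a\<close> modulo \<open>n\<close> are those of
  \<open>gcd a n\<close>: a congruence preserves the gcd with \<open>n\<close>, and conversely
  Bezout produces a multiplier.\<close>

lemma ex_pos_multiple_cong_iff:
  fixes a b n :: nat
  assumes "n > 0" "a > 0"
  shows "(\<exists>k>0. [b = k * a] (mod n)) \<longleftrightarrow> gcd a n dvd b"
proof
  assume "\<exists>k>0. [b = k * a] (mod n)"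
  then obtain k where "[b = k * a] (mod n)" by auto
  then have "gcd b n = gcd (k * a) n" by (rule cong_gcd_eq)
  then show "gcd a n dvd b" by (metis dvd_gcdD1 dvd_mult gcd_dvd1 gcd_dvd2 gcd_greatest)
next
  assume "gcd a n dvd b"
  then obtain c where c: "b = gcd a n * c" by auto
  obtain x where x: "[a * x = gcd a n] (mod n)"
    using cong_solve_nat[of a n] assms by auto
  have "[b = a * x * c] (mod n)"
    unfolding c using x by (intro cong_mult) (auto intro: cong_sym)
  \<comment> \<open>Adding \<open>n\<close> to the multiplier changes nothing modulo
    \<open>n\<close> but makes it positive even when \<open>x * c\<close> is 0.\<close>
  then have "[b = (x * c + n) * a] (mod n)"
    by (simp add: cong_def algebra_simps)
  then show "\<exists>k>0. [b = k * a] (mod n)"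
    using assms by (intro exI[of _ "x * c + n"]) simp
qed

text \<open>Passing to complementary divisors reverses divisibility, which turns gcds of exponents
  into orders. With \<open>n\<close> written as \<open>n div h * h\<close>, the common factor
  cancels.\<close>

lemma dvd_iff_cofactor_dvd:
  fixes g h n :: nat
  assumes "n > 0" "g dvd n" "h dvd n"
  shows "g dvd h \<longleftrightarrow> n div h dvd n div g"
proof -
  have "n div h dvd n div g \<longleftrightarrow> n div h * g dvd n div h * h"
    using assms by (auto simp: dvd_div_iff_mult)
  also have "\<dots> \<longleftrightarrow> g dvd h"
    using assms by (subst nat_mult_dvd_cancel_disj) (auto elim!: dvdE)
  finally show ?thesis ..
qed

lemma dihedral_power_iff:
  assumes "a \<in> {0<..n}" "b \<in> {0<..n}"
  shows "(\<exists>k::nat. k > 0 \<and> dihedral_elem n (b, f) = dihedral_elem n (a, e) [^]\<^bsub>dihedral_group n\<^esub> k) \<longleftrightarrow>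
    (if e then (b, f) \<in> {(a, e), (n, False)} else \<not> f \<and> n div gcd b n dvd n div gcd a n)"
proof (cases e)
  case True
  have "[b = a] (mod n) \<longleftrightarrow> b = a" "[b = 0] (mod n) \<longleftrightarrow> b = n"
    using assms cong_imp_eq_Ioc[of b a n] cong_imp_eq_Ioc[of b n n] by (auto simp: cong_def)
  then have "dihedral_elem n (b, f) = dihedral_elem n (a, e) [^]\<^bsub>dihedral_group n\<^esub> k \<longleftrightarrow>
      (b, f) = (if odd k then (a, True) else (n, False))" for k :: nat
    using True by (auto simp: dihedral_elem_eq_pow_iff)
  \<comment> \<open>The exponents 1 and 2 realise both parities, giving the reflection itself and
    the identity.\<close>
  moreover have "odd (1::nat)" "(1::nat) > 0" "even (2::nat)" "(2::nat) > 0" by auto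
  ultimately show ?thesis using True by (auto split: if_splits)
next
  case False
  have "gcd a n dvd b \<longleftrightarrow> gcd a n dvd gcd b n" by simp
  also have "\<dots> \<longleftrightarrow> n div gcd b n dvd n div gcd a n"
    using assms by (intro dvd_iff_cofactor_dvd) auto
  finally show ?thesis
    using False assms ex_pos_multiple_cong_iff[of n a b]
    by (auto simp: dihedral_elem_eq_pow_iff)
qed

section \<open>Isomorphism criteria for simple graphs and joined unions\<close>

lemma digraph_iso_simple_graph_ofI:
  assumes "bij_betw f A B"
    and "\<And>x y. \<lbrakk>x \<in> A; y \<in> A; x \<noteq> y\<rbrakk> \<Longrightarrow> P x y \<or> P y x \<longleftrightarrow> Q (f x) (f y) \<or> Q (f y) (f x)"
  shows "digraph_iso (with_proj (simple_graph_of A P)) (with_proj (simple_graph_of B Q))"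
proof -
  let ?G = "with_proj (simple_graph_of A P)"
  \<comment> \<open>Arcs are pairs of vertices, so the vertex map dictates the arc map.\<close>
  let ?h = "\<lparr>iso_verts = f, iso_arcs = map_prod f f, iso_head = snd, iso_tail = fst\<rparr>"
  have inj: "inj_on f A" and B: "B = f ` A"
    using assms(1) by (auto simp: bij_betw_def)
  have "wf_digraph ?G" by unfold_locales (auto simp: simple_graph_of_def)
  moreover have "inj_on (map_prod f f) (parcs (simple_graph_of A P))"
    using inj by (intro inj_onI) (auto simp: simple_graph_of_def inj_on_eq_iff)
  ultimately have "pre_digraph.digraph_isomorphism ?G ?h"
    using inj by (auto simp: pre_digraph.digraph_isomorphism_def simple_graph_of_def)
  moreover have "parcs (simple_graph_of B Q) = map_prod f f ` parcs (simple_graph_of A P)"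
  proof (intro equalityI subsetI)
    fix p assume "p \<in> parcs (simple_graph_of B Q)"
    then obtain x y where "x \<in> A" "y \<in> A" "x \<noteq> y" "p = (f x, f y)" "Q (f x) (f y) \<or> Q (f y) (f x)"
      by (auto simp: simple_graph_of_def B)
    then show "p \<in> map_prod f f ` parcs (simple_graph_of A P)"
      using assms(2)[of x y] by (intro image_eqI[of _ _ "(x, y)"]) (auto simp: simple_graph_of_def)
  next
    fix p assume "p \<in> map_prod f f ` parcs (simple_graph_of A P)"
    then obtain x y where "x \<in> A" "y \<in> A" "x \<noteq> y" "p = (f x, f y)" "P x y \<or> P y x"
      by (auto simp: simple_graph_of_def)
    then show "p \<in> parcs (simple_graph_of B Q)"
      using assms(2)[of x y] inj by (auto simp: simple_graph_of_def B inj_on_eq_iff)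
  qed
  then have "with_proj (simple_graph_of B Q) = app_iso ?h ?G"
    by (simp add: app_iso_def with_proj_def) (simp add: simple_graph_of_def B)
  ultimately show ?thesis unfolding digraph_iso_def by blast
qed

text \<open>Equal cardinalities give a bijection from each fibre of \<open>lab\<close> onto its
  block. As \<open>adj\<close> is required for arbitrary block vertices \<open>u\<close> and
  \<open>w\<close>, any choice of bijections works; this suits complete and edgeless blocks.\<close>

lemma digraph_iso_joined_unionI:
  assumes "finite A" and lab: "lab \<in> A \<rightarrow> pverts H"
    and fibre: "\<And>i. i \<in> pverts H \<Longrightarrow> finite (pverts (F i)) \<and> card {x \<in> A. lab x = i} = card (pverts (F i))"
    and adj: "\<And>x y u w. \<lbrakk>x \<in> A; y \<in> A; x \<noteq> y; u \<in> pverts (F (lab x)); w \<in> pverts (F (lab y));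
        lab x = lab y \<Longrightarrow> u \<noteq> w\<rbrakk> \<Longrightarrow>
      P x y \<or> P y x \<longleftrightarrow> (lab x, lab y) \<in> parcs H \<or> (lab y, lab x) \<in> parcs H \<or>
        lab x = lab y \<and> ((u, w) \<in> parcs (F (lab x)) \<or> (w, u) \<in> parcs (F (lab x)))"
  shows "digraph_iso (with_proj (simple_graph_of A P)) (with_proj (joined_union H F))"
proof -
  have "\<forall>i. \<exists>g. i \<in> pverts H \<longrightarrow> bij_betw g {x \<in> A. lab x = i} (pverts (F i))"
  proof
    fix i
    show "\<exists>g. i \<in> pverts H \<longrightarrow> bij_betw g {x \<in> A. lab x = i} (pverts (F i))"
      using fibre[of i] \<open>finite A\<close> by (cases "i \<in> pverts H") (auto intro: finite_same_card_bij)
  qed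
  then obtain g where g: "\<And>i. i \<in> pverts H \<Longrightarrow> bij_betw (g i) {x \<in> A. lab x = i} (pverts (F i))"
    by metis
  let ?f = "\<lambda>x. (lab x, g (lab x) x)"
  have img: "lab x \<in> pverts H" "g (lab x) x \<in> pverts (F (lab x))" if "x \<in> A" for x
    using lab g[of "lab x"] that by (auto dest: bij_betwE)
  have inj: "g (lab x) x \<noteq> g (lab y) y" if "x \<in> A" "y \<in> A" "x \<noteq> y" "lab x = lab y" for x y
    using g[of "lab x"] img(1)[of x] that by (auto simp: bij_betw_def inj_on_def)
  have "bij_betw ?f A (SIGMA i:pverts H. pverts (F i))"
    unfolding bij_betw_def
  proof
    show "inj_on ?f A" by (rule inj_onI) (metis inj prod.inject)
    have "(i, u) \<in> ?f ` A" if i: "i \<in> pverts H" "u \<in> pverts (F i)" for i u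
    proof -
      obtain x where "x \<in> A" "lab x = i" "u = g i x"
        using i g[of i] by (auto simp: bij_betw_def image_iff set_eq_iff)
      then show ?thesis by auto
    qed
    then show "?f ` A = (SIGMA i:pverts H. pverts (F i))" using img by auto
  qed
  then show ?thesis
    unfolding joined_union_def
  proof (rule digraph_iso_simple_graph_ofI)
    fix x y assume "x \<in> A" "y \<in> A" "x \<noteq> y"
    then show "P x y \<or> P y x \<longleftrightarrow>
      (case ?f x of (i, x) \<Rightarrow> \<lambda>(j, y). (i, j) \<in> parcs H \<or> i = j \<and> (x, y) \<in> parcs (F i)) (?f y) \<or>
      (case ?f y of (i, x) \<Rightarrow> \<lambda>(j, y). (i, j) \<in> parcs H \<or> i = j \<and> (x, y) \<in> parcs (F i)) (?f x)"
      using adj[of x y "g (lab x) x" "g (lab y) y"] img[of x] img[of y] inj[of x y] by auto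
  qed
qed


section \<open>The outer graph as the divisibility graph of \<open>n\<close>\<close>

definition order_vertex :: "nat \<Rightarrow> nat \<Rightarrow> (nat \<Rightarrow> nat) \<Rightarrow> nat \<Rightarrow> outer_vertex" where
  "order_vertex n t d m = (if m = 1 then V else if m = n then V' else Vi (inv_into {1..t} d m))"

context
  fixes n t :: nat and d :: "nat \<Rightarrow> nat"
  assumes n: "n \<ge> 2"
    and d: "bij_betw d {1..t} {k. k dvd n \<and> 1 < k \<and> k < n}"
begin

lemma order_vertex_cases:
  assumes "m dvd n"
  obtains "m = 1" "order_vertex n t d m = V"
  | "m = n" "order_vertex n t d m = V'"
  | i where "i \<in> {1..t}" "m = d i" "order_vertex n t d m = Vi i" "1 < m" "m < n"
proof (cases "m = 1 \<or> m = n")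
  case True
  then show thesis using that n by (auto simp: order_vertex_def)
next
  case False
  then have m: "m \<in> {k. k dvd n \<and> 1 < k \<and> k < n}"
    using assms n by (auto dest: dvd_imp_le simp: nat_neq_iff)
  define i where "i = inv_into {1..t} d m"
  have "i \<in> {1..t}"
    using m unfolding i_def bij_betw_imp_surj_on[OF d, symmetric] by (rule inv_into_into)
  moreover have "d i = m" using bij_betw_inv_into_right[OF d m] by (simp add: i_def)
  moreover have "order_vertex n t d m = Vi i"
    using False by (simp add: order_vertex_def i_def)
  ultimately show thesis using that(3)[of i] m by blast
qed

text \<open>Replaces the indices of the outer graph by the divisors of \<open>n\<close>, with the
  vertex for the reflections kept apart.\<close>

lemma pverts_outer_graph:
  "pverts (outer_graph t d) = insert (Vi (t + 1)) (order_vertex n t d ` {m. m dvd n})"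
proof -
  let ?o = "order_vertex n t d"
  have V: "?o 1 = V" "?o n = V'" using n by (auto simp: order_vertex_def)
  have Vi: "?o (d i) = Vi i" "d i dvd n" if "i \<in> {1..t}" for i
    using bij_betw_inv_into_left[OF d that] bij_betw_apply[OF d that] by (auto simp: order_vertex_def)
  have "?o m \<in> {V, V'} \<union> Vi ` {1..t}" if "m dvd n" for m
    using order_vertex_cases[OF that] by (metis UnCI UnI2 image_eqI insertCI)
  moreover have "V \<in> ?o ` {m. m dvd n}" "V' \<in> ?o ` {m. m dvd n}"
    using V by (auto intro: image_eqI[of _ _ 1] image_eqI[of _ _ n])
  moreover have "Vi i \<in> ?o ` {m. m dvd n}" if "i \<in> {1..t}" for i
    by (rule image_eqI[of _ _ "d i"]) (simp_all add: Vi[OF that])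
  ultimately have "?o ` {m. m dvd n} = {V, V'} \<union> Vi ` {1..t}" by blast
  moreover have "{1..t + 1} = insert (t + 1) {1..t}" by auto
  ultimately show ?thesis by (auto simp: outer_graph_def simple_graph_of_def)
qed

lemma order_vertex_neq_last: "m dvd n \<Longrightarrow> order_vertex n t d m \<noteq> Vi (t + 1)"
  by (erule order_vertex_cases) auto

lemma order_vertex_eq_iff:
  assumes "m dvd n" "k dvd n"
  shows "order_vertex n t d m = order_vertex n t d k \<longleftrightarrow> m = k"
proof
  assume eq: "order_vertex n t d m = order_vertex n t d k"
  show "m = k"
    by (rule order_vertex_cases[OF assms(1)]; rule order_vertex_cases[OF assms(2)];
        metis eq outer_vertex.distinct outer_vertex.inject)
qed simp

lemma block_order_vertex: "m dvd n \<Longrightarrow> block n t d (order_vertex n t d m) = complete_graph (totient m)"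
  by (erule order_vertex_cases) auto

text \<open>All adjacencies among these vertices are instances of divisibility: 1 divides every
  \<open>m\<close>, and every \<open>m\<close> here divides \<open>n\<close>.\<close>

lemma outer_graph_adj_order_vertex:
  assumes "m dvd n" "k dvd n"
  shows "(order_vertex n t d m, order_vertex n t d k) \<in> parcs (outer_graph t d) \<longleftrightarrow>
    m \<noteq> k \<and> (m dvd k \<or> k dvd m)"
proof -
  let ?E = "parcs (outer_graph t d)"
  have V: "(V, v) \<in> ?E" "(v, V) \<in> ?E" if "v \<noteq> V" "v \<in> {V, V'} \<union> Vi ` {1..t}" for v
    using that by (auto simp: outer_graph_def simple_graph_of_def)
  have V': "(V', Vi i) \<in> ?E" "(Vi i, V') \<in> ?E" if "i \<in> {1..t}" for i
    using that by (auto simp: outer_graph_def simple_graph_of_def)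
  \<comment> \<open>The definition lists only \<open>i < j\<close>; symmetrisation in
    \<open>simple_graph_of\<close> covers \<open>j < i\<close>.\<close>
  have Vi: "(Vi i, Vi j) \<in> ?E \<longleftrightarrow> i \<noteq> j \<and> (d i dvd d j \<or> d j dvd d i)"
    if "i \<in> {1..t}" "j \<in> {1..t}" for i j
    using that by (cases i j rule: linorder_cases) (auto simp: outer_graph_def simple_graph_of_def)
  have loopfree: "(v, v) \<notin> ?E" for v
    by (simp add: outer_graph_def simple_graph_of_def)
  show ?thesis
  proof (cases "m = k")
    case True
    then show ?thesis using loopfree by simp
  next
    case neq: False
    show ?thesis
    proof (cases rule: order_vertex_cases[OF assms(1)])
      case 1
      then show ?thesis
        using neq V(1) by (cases rule: order_vertex_cases[OF assms(2)]) simp_all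
    next
      case 2
      then show ?thesis
        using neq V(2) V'(1) assms by (cases rule: order_vertex_cases[OF assms(2)]) simp_all
    next
      case (3 i)
      note i = 3
      show ?thesis
      proof (cases rule: order_vertex_cases[OF assms(2)])
        case 1
        then show ?thesis using i V(2) by simp
      next
        case 2
        then show ?thesis using i V'(2) assms by simp
      next
        case (3 j)
        then show ?thesis using i Vi[of i j] neq by metis
      qed
    qed
  qed
qed

lemma outer_graph_last_adj: "(Vi (t + 1), w) \<in> parcs (outer_graph t d) \<longleftrightarrow> w = V"
  by (auto simp: outer_graph_def simple_graph_of_def)

lemma outer_graph_sym: "(v, w) \<in> parcs (outer_graph t d) \<longleftrightarrow> (w, v) \<in> parcs (outer_graph t d)"
  by (auto simp: outer_graph_def simple_graph_of_def)

lemma order_vertex_eq_V_iff: "m dvd n \<Longrightarrow> order_vertex n t d m = V \<longleftrightarrow> m = 1"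
  using n by (auto simp: order_vertex_def)

text \<open>Order \<open>m\<close> means gcd \<open>n div m\<close> with \<open>n\<close>, and the
  exponents with that gcd are counted by the totient of \<open>n div (n div m)\<close>, which is
  \<open>m\<close>.\<close>

lemma card_rotations_of_order:
  assumes "m dvd n"
  shows "card {a \<in> {0<..n}. n div gcd a n = m} = totient m"
proof -
  have "n div gcd a n = m \<longleftrightarrow> gcd a n = n div m" for a
    using n assms by (metis dvd_div_eq_0_iff gcd_dvd2 dvd_mult_div_cancel nonzero_mult_div_cancel_right
        dvd_div_mult_self not_numeral_le_zero mult_eq_0_iff)
  then have "card {a \<in> {0<..n}. n div gcd a n = m} = totient (n div (n div m))"
    using card_gcd_eq_totient[of n "n div m"] n dvd_div_mult_self[OF assms]
    by (simp add: dvdI[of n _ m])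
  then show ?thesis using n assms by (auto elim!: dvdE)
qed

section \<open>Labelling the elements and assembling the isomorphism\<close>

definition dihedral_label :: "nat \<times> bool \<Rightarrow> outer_vertex" where
  "dihedral_label = (\<lambda>(a, e). if e then Vi (t + 1) else order_vertex n t d (n div gcd a n))"

lemma div_gcd_dvd [simp]: "n div gcd a n dvd n"
  by (metis dvd_div_mult_self dvd_triv_left gcd_dvd2)

text \<open>No rotation is sent to the last vertex, so its fibre is the set of \<open>n\<close>
  reflections; by injectivity of \<open>order_vertex\<close> on divisors, every other fibre consists
  of the rotations of one order.\<close>

lemma dihedral_label_fibre:
  assumes "v \<in> pverts (outer_graph t d)"
  shows "card {x \<in> {0<..n} \<times> UNIV. dihedral_label x = v} = card (pverts (block n t d v))"
proof (cases "v = Vi (t + 1)")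
  case True
  have "{x \<in> {0<..n} \<times> UNIV. dihedral_label x = v} = {0<..n} \<times> {True}"
    using order_vertex_neq_last unfolding True by (auto simp: dihedral_label_def split: if_splits)
  then show ?thesis
    by (simp add: True edgeless_graph_def simple_graph_of_def card_cartesian_product)
next
  case False
  then obtain m where m: "m dvd n" "v = order_vertex n t d m"
    using assms by (auto simp: pverts_outer_graph)
  have "{x \<in> {0<..n} \<times> UNIV. dihedral_label x = v} = {a \<in> {0<..n}. n div gcd a n = m} \<times> {False}"
    using order_vertex_eq_iff[OF _ m(1)] False m(2)
    by (auto simp: dihedral_label_def split: if_splits)
  then show ?thesis
    using card_rotations_of_order[OF m(1)]
    by (simp add: card_cartesian_product m block_order_vertex
        complete_graph_def simple_graph_of_def)
qed

text \<open>Identifies the identity by its order; used to show that a reflection meets no other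
  rotation.\<close>

lemma div_gcd_eq_1_iff:
  assumes "a \<in> {0<..n}"
  shows "n div gcd a n = 1 \<longleftrightarrow> a = n"
proof
  assume a: "n div gcd a n = 1"
  then have "gcd a n = n" by (metis dvd_mult_div_cancel gcd_dvd2 mult.right_neutral)
  then have "n \<le> a" using assms gcd_le1_nat[of a n] by simp
  then show "a = n" using assms by simp
qed (use n in simp)

lemma power_graph_dihedral_iso_joined_union:
  "digraph_iso (with_proj (power_graph (dihedral_group n)))
    (with_proj (joined_union (outer_graph t d) (block n t d)))"
proof -
  let ?A = "{0<..n} \<times> (UNIV :: bool set)"
  let ?P = "\<lambda>x y. \<exists>k::nat. k > 0 \<and> dihedral_elem n y = dihedral_elem n x [^]\<^bsub>dihedral_group n\<^esub> k"
  \<comment> \<open>The power graph transported to coordinates, where labels are easy to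
    compute.\<close>
  let ?M = "with_proj (simple_graph_of ?A ?P)"
  have "digraph_iso ?M (with_proj (power_graph (dihedral_group n)))"
    unfolding power_graph_def using bij_betw_dihedral_elem[of n] n
    by (intro digraph_iso_simple_graph_ofI) auto
  moreover have "wf_digraph ?M" by unfold_locales (auto simp: simple_graph_of_def)
  ultimately have "digraph_iso (with_proj (power_graph (dihedral_group n))) ?M"
    by (rule digraph_iso_swap[rotated])
  also have "digraph_iso ?M (with_proj (joined_union (outer_graph t d) (block n t d)))"
  proof (rule digraph_iso_joined_unionI[where lab = dihedral_label])
    show "finite ?A" by simp
    show "dihedral_label \<in> ?A \<rightarrow> pverts (outer_graph t d)"
      by (auto simp: dihedral_label_def pverts_outer_graph)
    show "finite (pverts (block n t d v)) \<and>
      card {x \<in> ?A. dihedral_label x = v} = card (pverts (block n t d v))"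
      if "v \<in> pverts (outer_graph t d)" for v
      using dihedral_label_fibre[OF that]
      by (cases v) (auto simp: complete_graph_def edgeless_graph_def simple_graph_of_def)
    fix x y :: "nat \<times> bool" and u w :: nat
    assume xy: "x \<in> ?A" "y \<in> ?A" "x \<noteq> y"
      and uw: "u \<in> pverts (block n t d (dihedral_label x))" "w \<in> pverts (block n t d (dihedral_label y))"
        "dihedral_label x = dihedral_label y \<Longrightarrow> u \<noteq> w"
    obtain a e b f where ab: "x = (a, e)" "y = (b, f)" "a \<in> {0<..n}" "b \<in> {0<..n}"
      using xy by (cases x; cases y) auto
    have powers: "?P x y \<longleftrightarrow> (if e then (b, f) \<in> {(a, e), (n, False)}
          else \<not> f \<and> n div gcd b n dvd n div gcd a n)"
        "?P y x \<longleftrightarrow> (if f then (a, e) \<in> {(b, f), (n, False)}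
          else \<not> e \<and> n div gcd a n dvd n div gcd b n)"
      using ab by (simp_all add: dihedral_power_iff del: greaterThanAtMost_iff)
    \<comment> \<open>The last outer vertex has \<open>V\<close> as its only neighbour, and a
      rotation lies over \<open>V\<close> exactly when its exponent is \<open>n\<close>.\<close>
    have adj_last: "(order_vertex n t d (n div gcd c n), Vi (t + 1)) \<in> parcs (outer_graph t d) \<longleftrightarrow> c = n"
        "(Vi (t + 1), order_vertex n t d (n div gcd c n)) \<in> parcs (outer_graph t d) \<longleftrightarrow> c = n"
        "order_vertex n t d (n div gcd c n) \<noteq> Vi (t + 1)"
      if "c \<in> {0<..n}" for c
      using div_gcd_eq_1_iff[OF that] order_vertex_eq_V_iff[of "n div gcd c n"]
        outer_graph_sym[of _ "Vi (t + 1)"] outer_graph_last_adj order_vertex_neq_last div_gcd_dvd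
      by metis+
    consider "e" "f" | "e" "\<not> f" | "\<not> e" "f" | "\<not> e" "\<not> f" by blast
    then show "?P x y \<or> ?P y x \<longleftrightarrow>
      (dihedral_label x, dihedral_label y) \<in> parcs (outer_graph t d) \<or>
      (dihedral_label y, dihedral_label x) \<in> parcs (outer_graph t d) \<or>
      dihedral_label x = dihedral_label y \<and>
        ((u, w) \<in> parcs (block n t d (dihedral_label x)) \<or>
         (w, u) \<in> parcs (block n t d (dihedral_label x)))"
    proof cases
      \<comment> \<open>Distinct reflections are not powers of each other, and their common block is
        edgeless.\<close>
      case 1
      then show ?thesis
        unfolding powers using xy(3) ab
        by (auto simp: dihedral_label_def outer_graph_last_adj[simplified]
            edgeless_graph_def simple_graph_of_def)
    next
      case 2
      then have "dihedral_label x = Vi (t + 1)"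
        "dihedral_label y = order_vertex n t d (n div gcd b n)"
        by (simp_all add: ab dihedral_label_def)
      moreover have "?P x y \<or> ?P y x \<longleftrightarrow> b = n" unfolding powers using 2 by auto
      ultimately show ?thesis using adj_last[OF ab(4)] by metis
    next
      case 3
      then have "dihedral_label x = order_vertex n t d (n div gcd a n)"
        "dihedral_label y = Vi (t + 1)"
        by (simp_all add: ab dihedral_label_def)
      moreover have "?P x y \<or> ?P y x \<longleftrightarrow> a = n" unfolding powers using 3 by auto
      ultimately show ?thesis using adj_last[OF ab(3)] by metis
    next
      case 4
      define m k where "m = n div gcd a n" and "k = n div gcd b n"
      have mk: "m dvd n" "k dvd n" by (simp_all add: m_def k_def)
      have lab: "dihedral_label x = order_vertex n t d m" "dihedral_label y = order_vertex n t d k"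
        using 4 by (simp_all add: ab dihedral_label_def m_def k_def)
      have "?P x y \<or> ?P y x \<longleftrightarrow> k dvd m \<or> m dvd k"
        unfolding powers using 4 by (simp add: m_def k_def)
      \<comment> \<open>Rotations of equal order are powers of each other; correspondingly their
        labels agree, so \<open>u\<close> and \<open>w\<close> are distinct vertices of one complete
        block.\<close>
      moreover have "(u, w) \<in> parcs (block n t d (dihedral_label x))" if "m = k"
        using uw that unfolding lab block_order_vertex[OF mk(1)] block_order_vertex[OF mk(2)]
        by (simp add: complete_graph_def simple_graph_of_def)
      ultimately show ?thesis
        unfolding lab outer_graph_adj_order_vertex[OF mk]
          outer_graph_adj_order_vertex[OF mk(2) mk(1)] order_vertex_eq_iff[OF mk]
        by auto
    qed
  qed
  finally show ?thesis .
qed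

end

theorem mainTheorem4:
  fixes n t :: nat and d :: "nat \<Rightarrow> nat"
  assumes "n \<ge> 2"
    and "bij_betw d {1..t} {k. k dvd n \<and> 1 < k \<and> k < n}"
  shows "digraph_iso (with_proj (power_graph (dihedral_group n)))
           (with_proj (joined_union (outer_graph t d) (block n t d)))
       \<and> (\<forall>w. (Vi (t + 1), w) \<in> parcs (outer_graph t d) \<longleftrightarrow> w = V)"
  using power_graph_dihedral_iso_joined_union[OF assms] outer_graph_last_adj[OF assms] by blast

end
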